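(* Let $\Gamma=\bigcup_{i=1}^n\Gamma_i$ be an $n$-star-shaped graph in $\mathbb{R}^N$, with edges $\Gamma_i=[A_0,A_i]$, lengths $\ell_i=|A_i-A_0|$, unit vectors $\tau_i=(A_i-A_0)/\ell_i$, and first eigenvalue $$\lambda_1:=\inf\left\{\frac{\sum_{i=1}^n\int_{\Gamma_i}|\nabla_{\mathbb{R}\tau_i}u|^2\,d\mathcal{H}^1}{\sum_{i=0}^n u(A_i)^2}\;:\;u\in C^\infty(\mathbb{R}^N),\ \sum_{i=0}^n u(A_i)^2\neq0,\ \sum_{i=0}^n u(A_i)=0\right\}.$$ Then $$\lambda_1\sum_{i=1}^n\ell_i\le n+\left|\sum_{i=1}^n\tau_i\right|^2.$$
   Context: An $n$-star-shaped graph is the union of $n$ (nondegenerate) segments $\Gamma_i=[A_0,A_i]$ of $\mathbb{R}^N$, $1\le i\le n$, such that there do not exist two distinct indices $i,j$ with $\Gamma_i\subset\Gamma_j$. $\nabla_{\mathbb{R}\tau_i}u$ denotes the orthogonal projection of $\nabla u$ onto the line $\mathbb{R}\tau_i$. *)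

theory Defs
  imports "HOL-Analysis.Analysis"
begin

section \<open>One-dimensional Hausdorff measure\<close>

text \<open>
  No normalising constant is needed in dimension one. The library's \<^const>\<open>diameter\<close> is
  meaningful on bounded sets only, hence the boundedness condition on the covers.
\<close>

definition hausdorff1_pre :: "real \<Rightarrow> 'a::metric_space set \<Rightarrow> ennreal" where
  "hausdorff1_pre \<delta> A =
    (INF C \<in> {C :: nat \<Rightarrow> 'a set. A \<subseteq> (\<Union>j. C j) \<and> (\<forall>j. bounded (C j) \<and> diameter (C j) \<le> \<delta>)}.
       \<Sum>j. ennreal (diameter (C j)))"

definition hausdorff1_outer :: "'a::metric_space set \<Rightarrow> ennreal" where
  "hausdorff1_outer A = (SUP \<delta>\<in>{0<..}. hausdorff1_pre \<delta> A)"

definition hausdorff1 :: "'a::metric_space measure" where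
  "hausdorff1 = measure_of UNIV (sets borel) hausdorff1_outer"

subsection \<open>The construction yields a Borel measure\<close>

text \<open>
  A \<^const>\<open>measure_of\<close> term silently denotes the zero measure unless the given set function is
  countably additive; \<open>emeasure_hausdorff1\<close> below excludes this, and
  \<open>emeasure_hausdorff1_closed_segment\<close> confirms the normalisation.
\<close>

lemma hausdorff1_pre_mono: "A \<subseteq> B \<Longrightarrow> hausdorff1_pre \<delta> A \<le> hausdorff1_pre \<delta> B"
  unfolding hausdorff1_pre_def by (rule INF_superset_mono) auto

lemma hausdorff1_pre_le:
  assumes "A \<subseteq> (\<Union>j. C j)" "\<And>j::nat. bounded (C j)" "\<And>j. diameter (C j) \<le> \<delta>"
  shows "hausdorff1_pre \<delta> A \<le> (\<Sum>j. ennreal (diameter (C j)))"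
  unfolding hausdorff1_pre_def using assms by (intro INF_lower) auto

lemma hausdorff1_pre_empty: "0 \<le> \<delta> \<Longrightarrow> hausdorff1_pre \<delta> {} = 0"
  using hausdorff1_pre_le[of "{}" "\<lambda>_. {}" \<delta>] by simp

lemma hausdorff1_pre_countable_subadditive:
  "hausdorff1_pre \<delta> (\<Union>i. A i) \<le> (\<Sum>i. hausdorff1_pre \<delta> (A i))"
proof (rule ennreal_le_epsilon)
  let ?O = "hausdorff1_pre \<delta>"
  fix e :: real assume e: "0 < e" and fin: "(\<Sum>i. ?O (A i)) < top"
  have *: "?O (A n) < ?O (A n) + e * (1/2)^Suc n" for n
    using e fin by (auto simp add: less_top dest!: ennreal_suminf_lessD)
  have "\<exists>C :: nat \<Rightarrow> 'a set. A n \<subseteq> (\<Union>j. C j) \<and> (\<forall>j. bounded (C j) \<and> diameter (C j) \<le> \<delta>) \<and>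
      (\<Sum>j. ennreal (diameter (C j))) \<le> ?O (A n) + e * (1/2)^Suc n" for n
    using *[of n] unfolding hausdorff1_pre_def[of \<delta> "A n"] INF_less_iff
    by (auto intro: less_imp_le)
  then obtain B :: "nat \<Rightarrow> nat \<Rightarrow> 'a set" where
    sub: "\<And>n. A n \<subseteq> (\<Union>j. B n j)" and
    bd: "\<And>n j. bounded (B n j)" "\<And>n j. diameter (B n j) \<le> \<delta>" and
    le: "\<And>n. (\<Sum>j. ennreal (diameter (B n j))) \<le> ?O (A n) + e * (1/2)^Suc n"
    by metis
  define C where "C = case_prod B o prod_decode"
  have AC: "(\<Union>i. A i) \<subseteq> (\<Union>i. C i)"
    using sub by (auto simp add: C_def subset_eq) (metis prod.case prod_encode_inverse)
  have "?O (\<Union>i. A i) \<le> (\<Sum>j. ennreal (diameter (C j)))"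
    by (rule hausdorff1_pre_le[OF AC]) (auto simp: C_def bd split: prod.split)
  also have "\<dots> = (\<Sum>n. \<Sum>j. ennreal (diameter (B n j)))"
  proof -
    have "(\<Sum>i. (\<lambda>(n,j). ennreal (diameter (B n j))) (prod_decode i))
        = (\<Sum>n. \<Sum>j. ennreal (diameter (B n j)))"
      by (rule suminf_ennreal_2dimen) simp
    then show ?thesis by (simp add: C_def split_def)
  qed
  also have "\<dots> \<le> (\<Sum>n. ?O (A n) + e * (1/2) ^ Suc n)"
    by (intro suminf_le le) auto
  also have "\<dots> = (\<Sum>n. ?O (A n)) + (\<Sum>n. ennreal e * ennreal ((1/2) ^ Suc n))"
    using e by (subst suminf_add[symmetric])
               (auto simp del: ennreal_suminf_cmult simp add: ennreal_mult[symmetric])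
  also have "\<dots> = (\<Sum>n. ?O (A n)) + e"
    unfolding ennreal_suminf_cmult
    by (subst suminf_ennreal_eq[OF zero_le_power power_half_series]) auto
  finally show "?O (\<Union>i. A i) \<le> (\<Sum>n. ?O (A n)) + e" .
qed

lemma hausdorff1_pre_le_outer: "0 < \<delta> \<Longrightarrow> hausdorff1_pre \<delta> A \<le> hausdorff1_outer A"
  unfolding hausdorff1_outer_def by (rule SUP_upper) auto

lemma hausdorff1_pre_antimono:
  "\<delta> \<le> \<epsilon> \<Longrightarrow> hausdorff1_pre \<epsilon> A \<le> hausdorff1_pre \<delta> A"
  unfolding hausdorff1_pre_def by (rule INF_superset_mono) (auto intro: order_trans)

lemma hausdorff1_outer_mono: "A \<subseteq> B \<Longrightarrow> hausdorff1_outer A \<le> hausdorff1_outer B"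
  unfolding hausdorff1_outer_def by (intro SUP_mono') (rule hausdorff1_pre_mono)

lemma hausdorff1_outer_empty [simp]: "hausdorff1_outer {} = 0"
  unfolding hausdorff1_outer_def by (simp add: hausdorff1_pre_empty)

lemma hausdorff1_outer_countable_subadditive:
  "hausdorff1_outer (\<Union>i. A i) \<le> (\<Sum>i. hausdorff1_outer (A i))"
  unfolding hausdorff1_outer_def[of "\<Union>i. A i"]
proof (rule SUP_least)
  fix \<delta> :: real assume "\<delta> \<in> {0<..}"
  then have "(\<Sum>i. hausdorff1_pre \<delta> (A i)) \<le> (\<Sum>i. hausdorff1_outer (A i))"
    by (intro suminf_le hausdorff1_pre_le_outer) auto
  with hausdorff1_pre_countable_subadditive[of \<delta> A]
  show "hausdorff1_pre \<delta> (\<Union>i. A i) \<le> (\<Sum>i. hausdorff1_outer (A i))" by simp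
qed

lemma outer_measure_space_hausdorff1:
  "outer_measure_space UNIV (hausdorff1_outer :: 'a::metric_space set \<Rightarrow> ennreal)"
  unfolding outer_measure_space_def positive_def increasing_def countably_subadditive_def
  using hausdorff1_outer_countable_subadditive by (auto intro: hausdorff1_outer_mono)

lemma hausdorff1_outer_Un:
  "hausdorff1_outer (A \<union> B) \<le> hausdorff1_outer A + hausdorff1_outer B"
proof -
  interpret sigma_algebra UNIV "UNIV :: 'a set set" by (metis Pow_UNIV sigma_algebra_Pow)
  have "subadditive UNIV (hausdorff1_outer :: 'a set \<Rightarrow> ennreal)"
    using outer_measure_space_hausdorff1 countably_subadditive_subadditive
    unfolding outer_measure_space_def by blast
  then have "hausdorff1_outer (A \<union> (B - A)) \<le> hausdorff1_outer A + hausdorff1_outer (B - A)"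
    by (rule subadditiveD) auto
  also have "\<dots> \<le> hausdorff1_outer A + hausdorff1_outer B"
    by (intro add_left_mono hausdorff1_outer_mono) auto
  finally show ?thesis by simp
qed

lemma hausdorff1_outer_separated:
  assumes d: "0 < d" and sep: "\<And>a b. a \<in> A \<Longrightarrow> b \<in> B \<Longrightarrow> d \<le> dist a b"
  shows "hausdorff1_outer A + hausdorff1_outer B \<le> hausdorff1_outer (A \<union> B)"
proof -
  have pre: "hausdorff1_pre \<delta> A + hausdorff1_pre \<delta> B \<le> hausdorff1_pre \<delta> (A \<union> B)"
    if \<delta>: "0 < \<delta>" "\<delta> < d" for \<delta>
    unfolding hausdorff1_pre_def[of \<delta> "A \<union> B"]
  proof (rule INF_greatest)
    fix C :: "nat \<Rightarrow> 'a set"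
    assume C: "C \<in> {C. A \<union> B \<subseteq> (\<Union>j. C j) \<and> (\<forall>j. bounded (C j) \<and> diameter (C j) \<le> \<delta>)}"
    define D where "D S j = (if C j \<inter> S = {} then {} else C j)" for S j
    have 1: "hausdorff1_pre \<delta> S \<le> (\<Sum>j. ennreal (diameter (D S j)))" if "S \<subseteq> A \<union> B" for S
      using C that \<delta> by (intro hausdorff1_pre_le) (fastforce simp: D_def)+
    have 2: "ennreal (diameter (D A j)) + ennreal (diameter (D B j)) \<le> ennreal (diameter (C j))" for j
    proof (cases "C j \<inter> A = {} \<or> C j \<inter> B = {}")
      case True
      then show ?thesis by (auto simp: D_def)
    next
      case False
      then obtain a b where "a \<in> C j" "a \<in> A" "b \<in> C j" "b \<in> B" by auto
      moreover have "bounded (C j)" "diameter (C j) \<le> \<delta>" using C by auto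
      ultimately have "d \<le> \<delta>"
        using sep[of a b] diameter_bounded_bound[of "C j" a b] by linarith
      with \<delta> show ?thesis by simp
    qed
    have "hausdorff1_pre \<delta> A + hausdorff1_pre \<delta> B
        \<le> (\<Sum>j. ennreal (diameter (D A j))) + (\<Sum>j. ennreal (diameter (D B j)))"
      by (intro add_mono 1) auto
    also have "\<dots> = (\<Sum>j. ennreal (diameter (D A j)) + ennreal (diameter (D B j)))"
      by (intro suminf_add) auto
    also have "\<dots> \<le> (\<Sum>j. ennreal (diameter (C j)))"
      by (intro suminf_le 2) auto
    finally show "hausdorff1_pre \<delta> A + hausdorff1_pre \<delta> B \<le> (\<Sum>j. ennreal (diameter (C j)))" .
  qed
  have both: "hausdorff1_pre \<delta> A + hausdorff1_pre \<epsilon> B \<le> hausdorff1_outer (A \<union> B)"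
    if "0 < \<delta>" "0 < \<epsilon>" for \<delta> \<epsilon>
  proof -
    define \<eta> where "\<eta> = min (min \<delta> \<epsilon>) (d/2)"
    have \<eta>: "0 < \<eta>" "\<eta> < d" "\<eta> \<le> \<delta>" "\<eta> \<le> \<epsilon>" using that d by (auto simp: \<eta>_def)
    have "hausdorff1_pre \<delta> A + hausdorff1_pre \<epsilon> B \<le> hausdorff1_pre \<eta> A + hausdorff1_pre \<eta> B"
      using \<eta> by (intro add_mono hausdorff1_pre_antimono) auto
    also have "\<dots> \<le> hausdorff1_pre \<eta> (A \<union> B)" using \<eta> by (intro pre)
    also have "\<dots> \<le> hausdorff1_outer (A \<union> B)" using \<eta> by (intro hausdorff1_pre_le_outer)
    finally show ?thesis .
  qed
  have ne: "{0::real<..} \<noteq> {}" by (simp add: ex_gt_or_lt)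
  have "hausdorff1_outer A + hausdorff1_outer B
      = (SUP \<delta>\<in>{0<..}. hausdorff1_pre \<delta> A + hausdorff1_outer B)"
    unfolding hausdorff1_outer_def[of A] by (rule ennreal_SUP_add_left[symmetric, OF ne])
  also have "\<dots> \<le> hausdorff1_outer (A \<union> B)"
  proof (rule SUP_least)
    fix \<delta> :: real assume \<delta>: "\<delta> \<in> {0<..}"
    have "hausdorff1_pre \<delta> A + hausdorff1_outer B
        = (SUP \<epsilon>\<in>{0<..}. hausdorff1_pre \<delta> A + hausdorff1_pre \<epsilon> B)"
      unfolding hausdorff1_outer_def[of B] add.commute[of "hausdorff1_pre \<delta> A"]
      by (rule ennreal_SUP_add_left[symmetric, OF ne])
    also have "\<dots> \<le> hausdorff1_outer (A \<union> B)"
      using \<delta> both by (intro SUP_least) auto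
    finally show "hausdorff1_pre \<delta> A + hausdorff1_outer B \<le> hausdorff1_outer (A \<union> B)" .
  qed
  finally show ?thesis .
qed

lemma hausdorff1_outer_sum_separated:
  assumes "\<And>i j a b. i < j \<Longrightarrow> a \<in> R i \<Longrightarrow> b \<in> R j \<Longrightarrow> d (j::nat) \<le> dist a b" "\<And>j. 0 < d j"
  shows "(\<Sum>i<m. hausdorff1_outer (R i)) \<le> hausdorff1_outer (\<Union>i<m. R i)"
proof (induction m)
  case 0
  then show ?case by simp
next
  case (Suc m)
  have "(\<Sum>i<Suc m. hausdorff1_outer (R i)) \<le> hausdorff1_outer (\<Union>i<m. R i) + hausdorff1_outer (R m)"
    using Suc by (simp add: add_right_mono)
  also have "\<dots> \<le> hausdorff1_outer ((\<Union>i<m. R i) \<union> R m)"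
    using assms by (intro hausdorff1_outer_separated[of "d m"]) auto
  also have "(\<Union>i<m. R i) \<union> R m = (\<Union>i<Suc m. R i)"
    by (auto simp: less_Suc_eq)
  finally show ?case .
qed

lemma closed_caratheodory:
  fixes F :: "'a::metric_space set"
  assumes F: "closed F"
  shows "hausdorff1_outer (F \<inter> A) + hausdorff1_outer ((UNIV - F) \<inter> A) = hausdorff1_outer A"
proof (rule antisym)
  let ?H = "hausdorff1_outer :: 'a set \<Rightarrow> ennreal"
  show "?H A \<le> ?H (F \<inter> A) + ?H ((UNIV - F) \<inter> A)"
    using hausdorff1_outer_Un[of "F \<inter> A" "(UNIV - F) \<inter> A"]
    by (smt (verit) Compl_eq_Diff_UNIV Int_Un_distrib2 Un_Diff_cancel Int_UNIV_left Un_UNIV_right)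
  show "?H (F \<inter> A) + ?H ((UNIV - F) \<inter> A) \<le> ?H A"
  proof (cases "F = {} \<or> ?H A = top")
    case True
    then show ?thesis by auto
  next
    case False
    then have Fne: "F \<noteq> {}" and fin: "?H A < top" by (auto simp: less_top)
    define f where "f x = infdist x F" for x
    have f_dist: "f x - f y \<le> dist x y" for x y
      unfolding f_def using infdist_triangle_abs[of x F y] by linarith
    have f_pos: "0 < f x" if "x \<notin> F" for x
      using that F Fne in_closed_iff_infdist_zero[OF F Fne, of x] infdist_nonneg[of x F]
      by (auto simp: f_def)
    have f0: "f x = 0" if "x \<in> F" for x using that by (simp add: f_def)
    define G where "G n = {x \<in> A. 1 / Suc n \<le> f x}" for n
    define R where "R k = {x \<in> A. 1 / Suc (Suc k) \<le> f x \<and> f x < 1 / Suc k}" for k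
    have G_le: "?H (F \<inter> A) + ?H (G n) \<le> ?H A" for n
    proof -
      have "?H (F \<inter> A) + ?H (G n) \<le> ?H (F \<inter> A \<union> G n)"
      proof (rule hausdorff1_outer_separated[of "1 / Suc n"])
        fix a b assume "a \<in> F \<inter> A" "b \<in> G n"
        then show "1 / real (Suc n) \<le> dist a b"
          using f_dist[of b a] f0[of a] by (auto simp: G_def dist_commute)
      qed simp
      also have "\<dots> \<le> ?H A" by (rule hausdorff1_outer_mono) (auto simp: G_def)
      finally show ?thesis .
    qed
    have R_sep: "dist a b \<ge> 1 / Suc (Suc i) - 1 / Suc j" if "a \<in> R i" "b \<in> R j" for a b i j
      using that f_dist[of a b] by (auto simp: R_def)
    have half: "(\<Sum>i<m. ?H (R (2 * i + c))) \<le> ?H A" for m c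
    proof -
      have "(\<Sum>i<m. ?H (R (2 * i + c))) \<le> ?H (\<Union>i<m. R (2 * i + c))"
      proof (rule hausdorff1_outer_sum_separated
          [where d = "\<lambda>j. 1 / real (2 * j + c) - 1 / Suc (2 * j + c) + (if j = 0 then 2 else 0)"])
        fix i j :: nat and a b
        assume *: "i < j" "a \<in> R (2 * i + c)" "b \<in> R (2 * j + c)"
        have "1 / real (2 * j + c) \<le> 1 / Suc (Suc (2 * i + c))"
          using * by (intro divide_left_mono) auto
        with R_sep[OF *(2,3)] *(1)
        show "1 / real (2 * j + c) - 1 / real (Suc (2 * j + c)) + (if j = 0 then 2 else 0) \<le> dist a b"
          by simp
      next
        fix j :: nat
        show "0 < 1 / real (2 * j + c) - 1 / real (Suc (2 * j + c)) + (if j = 0 then 2 else 0)"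
        proof (cases "j = 0")
          case True
          have "1 / real (Suc c) \<le> 1" "0 \<le> 1 / real c" by simp_all
          then have "0 < 1 / real c - 1 / real (Suc c) + 2" by linarith
          then show ?thesis using True by (simp only: mult_0_right add_0 if_True refl)
        next
          case False
          then have "1 / real (Suc (2 * j + c)) < 1 / real (2 * j + c)"
            by (intro divide_strict_left_mono) auto
          then show ?thesis using False by simp
        qed
      qed
      also have "\<dots> \<le> ?H A" by (rule hausdorff1_outer_mono) (auto simp: R_def)
      finally show ?thesis .
    qed
    have split: "(\<Sum>i<2 * m. g i) = (\<Sum>i<m. g (2 * i + 0)) + (\<Sum>i<m. g (2 * i + 1))"
      for g :: "nat \<Rightarrow> ennreal" and m
      by (induction m) (simp_all add: algebra_simps)
    have part: "(\<Sum>i<m. ?H (R i)) \<le> ?H A + ?H A" for m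
    proof -
      have "(\<Sum>i<m. ?H (R i)) \<le> (\<Sum>i<2 * m. ?H (R i))"
        by (intro sum_mono2) auto
      also have "\<dots> \<le> ?H A + ?H A"
        unfolding split by (intro add_mono half)
      finally show ?thesis .
    qed
    have "(\<Sum>i. ?H (R i)) \<le> ?H A + ?H A"
      by (intro suminf_le_const summableI part)
    also have "\<dots> < top" using fin by (simp add: ennreal_add_less_top)
    finally have Rfin: "(\<Sum>i. ?H (R i)) \<noteq> top" by simp
    define r where "r i = enn2real (?H (R i))" for i
    have Rr: "?H (R i) = ennreal (r i)" for i
      unfolding r_def using ennreal_suminf_lessD[of "\<lambda>i. ?H (R i)" top] Rfin
      by (simp add: less_top)
    have r0: "0 \<le> r i" for i by (simp add: r_def)
    have rs: "summable r"
      by (rule summable_suminf_not_top) (use r0 Rfin in \<open>auto simp: Rr\<close>)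
    have tail: "?H ((UNIV - F) \<inter> A) \<le> ?H (G n) + ennreal (\<Sum>k. r (k + n))" for n
    proof -
      have cov: "(UNIV - F) \<inter> A \<subseteq> G n \<union> (\<Union>k. R (k + n))"
      proof
        fix x assume x: "x \<in> (UNIV - F) \<inter> A"
        show "x \<in> G n \<union> (\<Union>k. R (k + n))"
        proof (cases "x \<in> G n")
          case False
          obtain N where N: "1 / real (Suc N) < f x"
            using f_pos[of x] x nat_approx_posE[of "f x"] by auto
          define m where "m = (LEAST m. 1 / real (Suc m) \<le> f x)"
          have m: "1 / real (Suc m) \<le> f x"
            unfolding m_def by (rule LeastI[of _ N]) (use N in simp)
          have ml: "f x < 1 / real (Suc k)" if "k < m" for k
            using not_less_Least[of k "\<lambda>m. 1 / real (Suc m) \<le> f x"] that by (simp add: m_def)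
          have "n < m"
          proof (rule ccontr)
            assume "\<not> n < m"
            then have "1 / real (Suc n) \<le> 1 / real (Suc m)" by (intro divide_left_mono) auto
            with m False x show False by (auto simp: G_def)
          qed
          then have "x \<in> R ((m - 1 - n) + n)"
            using m ml[of "m - 1"] x by (auto simp: R_def)
          then show ?thesis by blast
        qed simp
      qed
      have "?H ((UNIV - F) \<inter> A) \<le> ?H (G n) + ?H (\<Union>k. R (k + n))"
        using hausdorff1_outer_mono[OF cov] hausdorff1_outer_Un by (rule order_trans)
      also have "?H (\<Union>k. R (k + n)) \<le> (\<Sum>k. ?H (R (k + n)))"
        by (rule hausdorff1_outer_countable_subadditive)
      also have "\<dots> = ennreal (\<Sum>k. r (k + n))"
        unfolding Rr using rs r0 by (intro suminf_ennreal2) (auto simp: summable_iff_shift)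
      finally show ?thesis by (simp add: add_left_mono)
    qed
    have "?H (F \<inter> A) + ?H ((UNIV - F) \<inter> A) \<le> ?H A + ennreal (\<Sum>k. r (k + n))" for n
    proof -
      have "?H (F \<inter> A) + ?H ((UNIV - F) \<inter> A) \<le> ?H (F \<inter> A) + (?H (G n) + ennreal (\<Sum>k. r (k + n)))"
        by (intro add_left_mono tail)
      also have "\<dots> = (?H (F \<inter> A) + ?H (G n)) + ennreal (\<Sum>k. r (k + n))" by (simp add: add.assoc)
      also have "\<dots> \<le> ?H A + ennreal (\<Sum>k. r (k + n))" by (intro add_right_mono G_le)
      finally show ?thesis .
    qed
    moreover have "(\<lambda>n. ?H A + ennreal (\<Sum>k. r (k + n))) \<longlonglongrightarrow> ?H A + ennreal 0"
      by (intro tendsto_add tendsto_const tendsto_ennrealI suminf_exist_split2 rs)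
    ultimately show ?thesis
      by (intro LIMSEQ_le_const[where X = "\<lambda>n. ?H A + ennreal (\<Sum>k. r (k + n))"]) auto
  qed
qed

lemma measure_space_hausdorff1:
  "measure_space UNIV (sets borel) (hausdorff1_outer :: 'a::metric_space set \<Rightarrow> ennreal)"
proof -
  let ?H = "hausdorff1_outer :: 'a set \<Rightarrow> ennreal"
  interpret S: sigma_algebra UNIV "UNIV :: 'a set set" by (metis Pow_UNIV sigma_algebra_Pow)
  have L: "measure_space UNIV (lambda_system UNIV UNIV ?H) ?H"
    by (rule S.caratheodory_lemma[OF outer_measure_space_hausdorff1])
  then interpret L: sigma_algebra UNIV "lambda_system UNIV UNIV ?H"
    by (simp add: measure_space_def)
  have "sets (borel :: 'a measure) = sigma_sets UNIV (Collect closed)"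
    by (simp add: borel_eq_closed)
  also have "\<dots> \<subseteq> lambda_system UNIV UNIV ?H"
    by (rule L.sigma_sets_subset) (auto simp: lambda_system_def closed_caratheodory)
  finally have "sets (borel :: 'a measure) \<subseteq> lambda_system UNIV UNIV ?H" .
  with L show ?thesis
    unfolding measure_space_def positive_def countably_additive_def
    by (auto intro!: sets.sigma_algebra_axioms[of borel, simplified] simp: subset_eq)
qed

lemma sets_hausdorff1 [simp, measurable_cong]: "sets hausdorff1 = sets borel"
  unfolding hausdorff1_def by (metis sets.sets_measure_of_eq space_borel)

lemma space_hausdorff1 [simp]: "space hausdorff1 = UNIV"
  unfolding hausdorff1_def by (metis sets.space_measure_of_eq space_borel)

lemma emeasure_hausdorff1:
  "A \<in> sets borel \<Longrightarrow> emeasure hausdorff1 A = hausdorff1_outer A"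
  using measure_space_hausdorff1
  by (intro emeasure_measure_of[OF hausdorff1_def]) (auto simp: measure_space_def)

lemma emeasure_hausdorff1_closed_segment:
  fixes a b :: "'a::euclidean_space"
  shows "emeasure hausdorff1 (closed_segment a b) = ennreal (dist a b)"
proof -
  let ?S = "closed_segment a b" and ?L = "dist a b"
  have "hausdorff1_outer ?S \<le> ennreal ?L"
    unfolding hausdorff1_outer_def
  proof (rule SUP_least)
    fix \<delta> :: real assume "\<delta> \<in> {0<..}"
    then have \<delta>: "0 < \<delta>" by simp
    obtain n :: nat where n: "0 < n" "?L / real n \<le> \<delta>"
    proof -
      obtain n :: nat where "?L / \<delta> < real n" using reals_Archimedean2 by blast
      then have "?L / real (Suc n) \<le> \<delta>" using \<delta> by (simp add: field_simps)
      then show ?thesis using that[of "Suc n"] by simp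
    qed
    define p where "p t = a + t *\<^sub>R (b - a)" for t
    define C where "C j = (if j < n then p ` {real j / n .. real (Suc j) / n} else {})" for j
    have p_dist: "dist (p s) (p t) = \<bar>s - t\<bar> * ?L" for s t
    proof -
      have "p s - p t = (s - t) *\<^sub>R (b - a)" by (simp add: p_def algebra_simps)
      then show ?thesis by (simp add: dist_norm norm_minus_commute)
    qed
    have dC: "diameter (C j) \<le> (if j < n then ?L / n else 0)" for j
    proof (cases "j < n")
      case True
      have "norm (x - y) \<le> ?L / n" if "x \<in> C j" "y \<in> C j" for x y
      proof -
        from that True obtain s t where st: "x = p s" "y = p t"
          "s \<in> {real j / n .. real (Suc j) / n}" "t \<in> {real j / n .. real (Suc j) / n}"
          by (auto simp: C_def)
        have "\<bar>s - t\<bar> \<le> real (Suc j) / n - real j / n" using st(3,4) by auto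
        also have "\<dots> = 1 / n" by (simp add: diff_divide_distrib[symmetric])
        finally have "\<bar>s - t\<bar> * ?L \<le> 1 / n * ?L" by (intro mult_right_mono) auto
        then show ?thesis using p_dist[of s t] st by (simp add: dist_norm)
      qed
      then have "diameter (C j) \<le> ?L / n" by (intro diameter_le) auto
      then show ?thesis using True by simp
    qed (simp add: C_def)
    have cov: "?S \<subseteq> (\<Union>j. C j)"
    proof
      fix x assume "x \<in> ?S"
      then obtain t where t: "0 \<le> t" "t \<le> 1" "x = p t"
        by (auto simp: closed_segment_def p_def algebra_simps)
      show "x \<in> (\<Union>j. C j)"
      proof (cases "t = 1")
        case True
        then have "x \<in> C (n - 1)" using n t by (auto simp: C_def intro!: imageI)
        then show ?thesis by blast
      next
        case False
        define j where "j = nat \<lfloor>t * n\<rfloor>"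
        have j: "real j \<le> t * n" "t * n < real (Suc j)"
          using t real_of_int_floor_add_one_gt[of "t * n"] by (auto simp: j_def add.commute)
        have "t * n < n" using t False n by simp
        then have "j < n" using j by linarith
        moreover have "t \<in> {real j / n .. real (Suc j) / n}" using j n by (simp add: field_simps)
        ultimately have "x \<in> C j" using t by (auto simp: C_def)
        then show ?thesis by blast
      qed
    qed
    have bC: "bounded (C j)" for j
    proof (cases "j < n")
      case True
      have "continuous_on {real j / n .. real (Suc j) / n} p"
        unfolding p_def by (intro continuous_intros)
      then show ?thesis using True
        by (auto simp: C_def intro!: compact_imp_bounded compact_continuous_image)
    qed (simp add: C_def)
    have "hausdorff1_pre \<delta> ?S \<le> (\<Sum>j. ennreal (diameter (C j)))"
    proof (rule hausdorff1_pre_le[OF cov bC])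
      show "diameter (C j) \<le> \<delta>" for j
        using dC[of j] n \<delta> by (cases "j < n") auto
    qed
    also have "\<dots> \<le> (\<Sum>j. if j < n then ennreal (?L / n) else 0)"
    proof (intro suminf_le)
      show "ennreal (diameter (C j)) \<le> (if j < n then ennreal (?L / n) else 0)" for j
        using dC[of j] by (cases "j < n") (simp_all add: ennreal_leI ennreal_eq_0_iff)
    qed auto
    also have "\<dots> = (\<Sum>j<n. ennreal (?L / n))"
      by (subst suminf_finite[of "{..<n}"]) auto
    also have "\<dots> = ennreal ?L"
      using n by (simp add: ennreal_of_nat_eq_real_of_nat flip: ennreal_mult)
    finally show "hausdorff1_pre \<delta> ?S \<le> ennreal ?L" .
  qed
  moreover have "ennreal ?L \<le> hausdorff1_outer ?S"
  proof (cases "a = b")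
    case False
    then have L: "0 < ?L" by simp
    have "ennreal ?L \<le> hausdorff1_pre 1 ?S"
      unfolding hausdorff1_pre_def
    proof (rule INF_greatest)
      fix C :: "nat \<Rightarrow> 'a set"
      assume "C \<in> {C. ?S \<subseteq> (\<Union>j. C j) \<and> (\<forall>j. bounded (C j) \<and> diameter (C j) \<le> 1)}"
      then have C: "?S \<subseteq> (\<Union>j. C j)" "\<And>j. bounded (C j)" by auto
      define f where "f x = (x - a) \<bullet> (b - a) / ?L" for x
      have f_dist: "f x - f y \<le> dist x y" for x y
      proof -
        have "f x - f y = (x - y) \<bullet> (b - a) / ?L"
          by (simp add: f_def diff_divide_distrib[symmetric] inner_diff_left)
        also have "\<dots> \<le> norm (x - y) * norm (b - a) / ?L"
          using L by (intro divide_right_mono norm_cauchy_schwarz) auto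
        also have "\<dots> = dist x y" using L by (simp add: dist_norm norm_minus_commute)
        finally show ?thesis .
      qed
      define I where "I j = (if C j = {} then {} else {Inf (f ` C j) .. Sup (f ` C j)})" for j
      have bf: "f y - diameter (C j) \<le> f x \<and> f x \<le> f y + diameter (C j)"
        if "x \<in> C j" "y \<in> C j" for x y j
        using f_dist[of x y] f_dist[of y x] diameter_bounded_bound[OF C(2) that]
        by (auto simp: dist_commute)
      have bdd: "bdd_above (f ` C j)" "bdd_below (f ` C j)" if "C j \<noteq> {}" for j
      proof -
        from that obtain y where "y \<in> C j" by auto
        then show "bdd_above (f ` C j)" "bdd_below (f ` C j)"
          using bf by (meson bdd_aboveI2 bdd_belowI2)+
      qed
      have mI: "emeasure lborel (I j) \<le> ennreal (diameter (C j))" for j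
      proof (cases "C j = {}")
        case ne: False
        have "Sup (f ` C j) \<le> f y + diameter (C j)" if "y \<in> C j" for y
          using that bf by (intro cSUP_least) auto
        then have "Sup (f ` C j) - diameter (C j) \<le> Inf (f ` C j)"
          using ne by (intro cINF_greatest) (auto simp: diff_le_eq)
        moreover have "0 \<le> diameter (C j)" using C(2) by (rule diameter_ge_0)
        ultimately show ?thesis
          by (cases "Inf (f ` C j) \<le> Sup (f ` C j)") (auto simp: I_def ne intro: ennreal_leI)
      qed (simp add: I_def)
      have cov: "{0..?L} \<subseteq> (\<Union>j. I j)"
      proof
        fix s assume s: "s \<in> {0..?L}"
        define x where "x = a + (s / ?L) *\<^sub>R (b - a)"
        have "x \<in> ?S"
          unfolding closed_segment_def using s L
          by (auto simp: x_def algebra_simps intro!: exI[of _ "s / ?L"])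
        with C obtain j where j: "x \<in> C j" by auto
        have "(b - a) \<bullet> (b - a) = ?L * ?L"
          by (simp add: dist_norm norm_minus_commute dot_square_norm power2_eq_square)
        then have "f x = s" using L by (simp add: f_def x_def)
        moreover have "f x \<in> I j"
          using j bdd[of j] by (auto simp: I_def intro: cINF_lower cSUP_upper)
        ultimately show "s \<in> (\<Union>j. I j)" by blast
      qed
      have "ennreal ?L = emeasure lborel {0..?L}" by simp
      also have "\<dots> \<le> emeasure lborel (\<Union>j. I j)"
        using cov by (rule emeasure_mono) (auto simp: I_def)
      also have "\<dots> \<le> (\<Sum>j. emeasure lborel (I j))"
        by (rule emeasure_subadditive_countably) (auto simp: I_def)
      also have "\<dots> \<le> (\<Sum>j. ennreal (diameter (C j)))" by (intro suminf_le mI) auto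
      finally show "ennreal ?L \<le> (\<Sum>j. ennreal (diameter (C j)))" .
    qed
    also have "\<dots> \<le> hausdorff1_outer ?S" by (rule hausdorff1_pre_le_outer) simp
    finally show ?thesis .
  qed simp
  ultimately show ?thesis
    by (simp add: emeasure_hausdorff1)
qed

section \<open>Smooth functions, gradients and orthogonal projections\<close>

text \<open>Membership in \<open>C\<^sup>k\<close>: all directional derivatives are required to be of class \<open>C\<^sup>k\<^sup>-\<^sup>1\<close>.\<close>

primrec Ck :: "nat \<Rightarrow> ('a::real_normed_vector \<Rightarrow> 'b::real_normed_vector) \<Rightarrow> bool" where
  "Ck 0 f \<longleftrightarrow> continuous_on UNIV f"
| "Ck (Suc k) f \<longleftrightarrow>
    (\<forall>x. f differentiable (at x)) \<and> (\<forall>v. Ck k (\<lambda>x. frechet_derivative f (at x) v))"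

definition smooth :: "('a::real_normed_vector \<Rightarrow> 'b::real_normed_vector) \<Rightarrow> bool" where
  "smooth f \<longleftrightarrow> (\<forall>k. Ck k f)"

definition gradient :: "('a::real_inner \<Rightarrow> real) \<Rightarrow> 'a \<Rightarrow> 'a" where
  "gradient u x = (THE D. GDERIV u x :> D)"

definition orthogonal_projection :: "'a::real_inner set \<Rightarrow> 'a \<Rightarrow> 'a" where
  "orthogonal_projection S v = (THE p. p \<in> S \<and> (\<forall>w\<in>S. orthogonal (v - p) w))"

lemma gradient_eqI: "GDERIV u x :> D \<Longrightarrow> gradient u x = D"
  unfolding gradient_def
proof (rule the_equality)
  fix E assume "GDERIV u x :> D" "GDERIV u x :> E"
  then have "(\<lambda>h. h \<bullet> E) = (\<lambda>h. h \<bullet> D)"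
    unfolding gderiv_def by (rule has_derivative_unique[symmetric])
  then have "(E - D) \<bullet> (E - D) = 0" by (metis inner_diff_right right_minus_eq)
  then show "E = D" by simp
qed

lemma orthogonal_projection_line:
  assumes "norm w = 1"
  shows "orthogonal_projection (span {w}) v = (v \<bullet> w) *\<^sub>R w"
  unfolding orthogonal_projection_def
proof (rule the_equality)
  have w: "w \<bullet> w = 1" using assms by (simp add: dot_square_norm)
  then show "(v \<bullet> w) *\<^sub>R w \<in> span {w} \<and> (\<forall>y\<in>span {w}. orthogonal (v - (v \<bullet> w) *\<^sub>R w) y)"
    by (auto simp: span_singleton orthogonal_def inner_diff_left)
  fix p assume "p \<in> span {w} \<and> (\<forall>y\<in>span {w}. orthogonal (v - p) y)"
  then obtain k where "p = k *\<^sub>R w" and "orthogonal (v - p) w"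
    by (metis imageE insertI1 span_base span_singleton)
  with w show "p = (v \<bullet> w) *\<^sub>R w" by (simp add: orthogonal_def inner_diff_left)
qed

section \<open>Star-shaped graphs\<close>

text \<open>
  The vertices are given as \<open>A 0, \<dots>, A n\<close>, with centre \<open>A 0\<close>; edges are indexed by \<open>1, \<dots>, n\<close>.
\<close>

definition edge :: "(nat \<Rightarrow> 'a::real_vector) \<Rightarrow> nat \<Rightarrow> 'a set" where
  "edge A i = closed_segment (A 0) (A i)"

definition edge_length :: "(nat \<Rightarrow> 'a::real_normed_vector) \<Rightarrow> nat \<Rightarrow> real" where
  "edge_length A i = norm (A i - A 0)"

definition edge_dir :: "(nat \<Rightarrow> 'a::real_normed_vector) \<Rightarrow> nat \<Rightarrow> 'a" where
  "edge_dir A i = (A i - A 0) /\<^sub>R edge_length A i"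

definition star_shaped_graph :: "nat \<Rightarrow> (nat \<Rightarrow> 'a::real_vector) \<Rightarrow> 'a set \<Rightarrow> bool" where
  "star_shaped_graph n A \<Gamma> \<longleftrightarrow>
    1 \<le> n \<and>
    (\<forall>i\<in>{1..n}. A i \<noteq> A 0) \<and>
    (\<forall>i\<in>{1..n}. \<forall>j\<in>{1..n}. i \<noteq> j \<longrightarrow> \<not> edge A i \<subseteq> edge A j) \<and>
    \<Gamma> = (\<Union>i\<in>{1..n}. edge A i)"

definition dirichlet_energy ::
    "nat \<Rightarrow> (nat \<Rightarrow> 'a::euclidean_space) \<Rightarrow> ('a \<Rightarrow> real) \<Rightarrow> real" where
  "dirichlet_energy n A u =
    (\<Sum>i=1..n. LINT x:edge A i|hausdorff1.
       (norm (orthogonal_projection (span {edge_dir A i}) (gradient u x)))\<^sup>2)"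

definition first_eigenvalue :: "nat \<Rightarrow> (nat \<Rightarrow> 'a::euclidean_space) \<Rightarrow> real" where
  "first_eigenvalue n A =
    Inf {dirichlet_energy n A u / (\<Sum>i=0..n. (u (A i))\<^sup>2) | u.
           smooth u \<and> (\<Sum>i=0..n. (u (A i))\<^sup>2) \<noteq> 0 \<and> (\<Sum>i=0..n. u (A i)) = 0}"

end

theory Submission
  imports Defs
begin

text \<open>
  Only affine test functions are needed. Let \<open>c\<close> be the centroid of the vertices. Testing with
  \<open>u x = (x - c) \<bullet> b\<close> and summing over an orthonormal basis gives
  \<open>\<lambda>\<^sub>1 \<Sum>\<^sub>i |A\<^sub>i - c|\<^sup>2 \<le> \<Sum>\<^sub>i \<ell>\<^sub>i\<close>.
  The vectors \<open>V\<^sub>i = \<tau>\<^sub>i\<close> for \<open>i \<ge> 1\<close> and \<open>V\<^sub>0 = - \<Sum>\<^sub>i \<tau>\<^sub>i\<close> sum to zero, so that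
  \<open>\<Sum>\<^sub>i (A\<^sub>i - c) \<bullet> V\<^sub>i = \<Sum>\<^sub>i \<ell>\<^sub>i\<close>, and by Cauchy--Schwarz
  \<open>(\<Sum>\<^sub>i \<ell>\<^sub>i)\<^sup>2 \<le> \<Sum>\<^sub>i |A\<^sub>i - c|\<^sup>2 \<cdot> (n + |\<Sum>\<^sub>i \<tau>\<^sub>i|\<^sup>2)\<close>.
\<close>

lemma Ck_const: "Ck k (\<lambda>x::'a::real_normed_vector. c)"
proof (induction k arbitrary: c)
  case (Suc k)
  then show ?case by simp
qed simp

lemma smooth_inner_left: "smooth (\<lambda>x::'a::real_inner. (x - c) \<bullet> b)"
  unfolding smooth_def
proof
  fix k
  have D: "((\<lambda>x. (x - c) \<bullet> b) has_derivative (\<lambda>h. h \<bullet> b)) (at x)" for x :: 'a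
    by (auto intro!: derivative_eq_intros)
  then have "frechet_derivative (\<lambda>x. (x - c) \<bullet> b) (at x) = (\<lambda>h. h \<bullet> b)" for x
    using frechet_derivative_at by metis
  \<comment> \<open>For positive \<open>k\<close> each directional derivative is constant in
    \<open>x\<close>, so \<open>Ck_const\<close> applies.\<close>
  then show "Ck k (\<lambda>x. (x - c) \<bullet> b)"
    using D by (cases k) (auto simp: Ck_const differentiable_def intro!: continuous_intros)
qed

lemma gradient_inner_left: "gradient (\<lambda>x::'a::real_inner. (x - c) \<bullet> b) x = b"
  by (rule gradient_eqI) (auto simp: gderiv_def intro!: derivative_eq_intros)

text \<open>Divergent integrals default to 0, so nonnegativity holds for every \<open>u\<close>. It
  bounds from below the set whose \<open>Inf\<close> defines
  \<open>first_eigenvalue\<close>.\<close>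

lemma dirichlet_energy_nonneg: "0 \<le> dirichlet_energy n A u"
  unfolding dirichlet_energy_def set_lebesgue_integral_def
  by (intro sum_nonneg Bochner_Integration.integral_nonneg) auto

lemma norm_edge_dir: "A i \<noteq> A 0 \<Longrightarrow> norm (edge_dir A i) = 1"
  by (simp add: edge_dir_def edge_length_def)

lemma edge_length_scaleR_edge_dir: "edge_length A i *\<^sub>R edge_dir A i = A i - A 0"
  by (cases "A i = A 0") (simp_all add: edge_dir_def edge_length_def)

lemma measure_edge:
  fixes A :: "nat \<Rightarrow> 'a::euclidean_space"
  shows "measure hausdorff1 (edge A i) = edge_length A i"
  by (simp add: measure_def edge_def edge_length_def emeasure_hausdorff1_closed_segment
      dist_norm norm_minus_commute)

text \<open>The gradient is constantly \<open>b\<close>, and its projection onto a unit direction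
  has squared norm \<open>(b \<bullet> edge_dir A i)\<^sup>2\<close>; integrating this constant
  gives a factor of the edge length.\<close>

lemma dirichlet_energy_inner_left:
  fixes A :: "nat \<Rightarrow> 'a::euclidean_space"
  assumes "\<forall>i\<in>{1..n}. A i \<noteq> A 0"
  shows "dirichlet_energy n A (\<lambda>x. (x - c) \<bullet> b) =
    (\<Sum>i=1..n. edge_length A i * (b \<bullet> edge_dir A i)\<^sup>2)"
  unfolding dirichlet_energy_def
proof (rule sum.cong[OF refl])
  fix i assume "i \<in> {1..n}"
  then have "norm (edge_dir A i) = 1" using assms by (intro norm_edge_dir) auto
  moreover have "edge A i \<in> sets hausdorff1" "emeasure hausdorff1 (edge A i) \<noteq> \<infinity>"
    by (simp_all add: edge_def emeasure_hausdorff1_closed_segment)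
  ultimately show "(LINT x:edge A i|hausdorff1.
        (norm (orthogonal_projection (span {edge_dir A i}) (gradient (\<lambda>x. (x - c) \<bullet> b) x)))\<^sup>2)
      = edge_length A i * (b \<bullet> edge_dir A i)\<^sup>2"
    by (simp add: gradient_inner_left orthogonal_projection_line
        set_lebesgue_integral_def measure_edge)
qed

text \<open>Clearing the denominator also admits functions that vanish at every vertex, so
  coordinates can be summed without checking which of them are admissible in the infimum.\<close>

lemma first_eigenvalue_le:
  assumes "smooth u" "(\<Sum>i=0..n. u (A i)) = 0"
  shows "first_eigenvalue n A * (\<Sum>i=0..n. (u (A i))\<^sup>2) \<le> dirichlet_energy n A u"
proof (cases "(\<Sum>i=0..n. (u (A i))\<^sup>2) = 0")
  case True
  then show ?thesis by (simp add: dirichlet_energy_nonneg)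
next
  case False
  moreover have "0 \<le> (\<Sum>i=0..n. (u (A i))\<^sup>2)" by (simp add: sum_nonneg)
  ultimately have pos: "0 < (\<Sum>i=0..n. (u (A i))\<^sup>2)" by linarith
  have "first_eigenvalue n A \<le> dirichlet_energy n A u / (\<Sum>i=0..n. (u (A i))\<^sup>2)"
    unfolding first_eigenvalue_def
    by (rule cInf_lower)
       (use assms False in \<open>auto intro!: bdd_belowI[of _ 0] divide_nonneg_nonneg sum_nonneg
          dirichlet_energy_nonneg\<close>)
  with pos show ?thesis by (simp add: pos_le_divide_eq)
qed

lemma sum_Basis_inner_power2:
  fixes x :: "'a::euclidean_space"
  shows "(\<Sum>b\<in>Basis. (b \<bullet> x)\<^sup>2) = (norm x)\<^sup>2"
  unfolding power2_norm_eq_inner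
  by (subst (2) euclidean_inner) (simp add: power2_eq_square inner_commute)

lemma first_eigenvalue_mult_variance_le:
  fixes A :: "nat \<Rightarrow> 'a::euclidean_space"
  assumes A: "\<forall>i\<in>{1..n}. A i \<noteq> A 0" and c: "(\<Sum>i=0..n. A i - c) = 0"
  shows "first_eigenvalue n A * (\<Sum>i=0..n. (norm (A i - c))\<^sup>2) \<le> (\<Sum>i=1..n. edge_length A i)"
proof -
  have "(\<Sum>i=0..n. (norm (A i - c))\<^sup>2) = (\<Sum>b\<in>Basis. \<Sum>i=0..n. ((A i - c) \<bullet> b)\<^sup>2)"
    by (subst sum.swap) (simp add: sum_Basis_inner_power2[symmetric] inner_commute)
  then have "first_eigenvalue n A * (\<Sum>i=0..n. (norm (A i - c))\<^sup>2)
      = (\<Sum>b\<in>Basis. first_eigenvalue n A * (\<Sum>i=0..n. ((A i - c) \<bullet> b)\<^sup>2))"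
    by (simp add: sum_distrib_left)
  \<comment> \<open>By the choice of \<open>c\<close>, each test function has vertex sum
    zero.\<close>
  also have "\<dots> \<le> (\<Sum>b\<in>Basis. dirichlet_energy n A (\<lambda>x. (x - c) \<bullet> b))"
    using c by (intro sum_mono first_eigenvalue_le smooth_inner_left)
      (simp flip: inner_sum_left)
  also have "\<dots> = (\<Sum>i=1..n. edge_length A i * (\<Sum>b\<in>Basis. (b \<bullet> edge_dir A i)\<^sup>2))"
    by (simp add: dirichlet_energy_inner_left[OF A] sum_distrib_left sum.swap[of _ Basis])
  also have "\<dots> = (\<Sum>i=1..n. edge_length A i)"
    using A by (intro sum.cong) (simp_all add: sum_Basis_inner_power2 norm_edge_dir)
  finally show ?thesis .
qed

lemma sum_edge_length_power2_le:
  fixes A :: "nat \<Rightarrow> 'a::real_inner"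
  assumes A: "\<forall>i\<in>{1..n}. A i \<noteq> A 0"
  shows "(\<Sum>i=1..n. edge_length A i)\<^sup>2
    \<le> (\<Sum>i=0..n. (norm (A i - c))\<^sup>2) * (real n + (norm (\<Sum>i=1..n. edge_dir A i))\<^sup>2)"
proof -
  \<comment> \<open>The value at 0 makes the \<open>V i\<close> sum to zero, so the bound holds for
    any \<open>c\<close>.\<close>
  define V where "V i = (if i = 0 then - (\<Sum>i=1..n. edge_dir A i) else edge_dir A i)" for i
  have split: "(\<Sum>i=0..n. f i) = f 0 + (\<Sum>i=1..n. f i)" for f :: "nat \<Rightarrow> real"
    by (simp add: sum.atLeast_Suc_atMost)
  have "(\<Sum>i=1..n. edge_length A i) = (\<Sum>i=1..n. (A i - A 0) \<bullet> edge_dir A i)"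
  proof (rule sum.cong[OF refl])
    fix i assume "i \<in> {1..n}"
    then have "edge_dir A i \<bullet> edge_dir A i = 1"
      using A norm_edge_dir[of A i] by (simp add: dot_square_norm)
    then show "edge_length A i = (A i - A 0) \<bullet> edge_dir A i"
      by (simp flip: edge_length_scaleR_edge_dir)
  qed
  also have "\<dots> = (\<Sum>i=1..n. (A i - c) \<bullet> edge_dir A i - (A 0 - c) \<bullet> edge_dir A i)"
    by (simp add: inner_diff_left)
  also have "\<dots> = (\<Sum>i=0..n. (A i - c) \<bullet> V i)"
    by (simp add: split V_def sum_subtractf inner_sum_right)
  also have "\<dots> \<le> (\<Sum>i=0..n. norm (A i - c) * norm (V i))"
    by (intro sum_mono norm_cauchy_schwarz)
  finally have "(\<Sum>i=1..n. edge_length A i) \<le> (\<Sum>i=0..n. norm (A i - c) * norm (V i))" .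
  then have "(\<Sum>i=1..n. edge_length A i)\<^sup>2 \<le> (\<Sum>i=0..n. norm (A i - c) * norm (V i))\<^sup>2"
    by (intro power_mono sum_nonneg) (simp_all add: edge_length_def)
  also have "\<dots> \<le> (\<Sum>i=0..n. (norm (A i - c))\<^sup>2) * (\<Sum>i=0..n. (norm (V i))\<^sup>2)"
    by (rule Cauchy_Schwarz_ineq_sum)
  also have "(\<Sum>i=0..n. (norm (V i))\<^sup>2) = real n + (norm (\<Sum>i=1..n. edge_dir A i))\<^sup>2"
    using A by (simp add: split V_def norm_edge_dir)
  finally show ?thesis .
qed

theorem proposition5p2:
  fixes n :: nat and A :: "nat \<Rightarrow> real ^ 'N" and \<Gamma> :: "(real ^ 'N) set"
  assumes "star_shaped_graph n A \<Gamma>"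
  shows "first_eigenvalue n A * (\<Sum>i=1..n. edge_length A i)
           \<le> real n + (norm (\<Sum>i=1..n. edge_dir A i))\<^sup>2"
proof -
  let ?ev = "first_eigenvalue n A" and ?L = "\<Sum>i=1..n. edge_length A i"
  let ?S = "real n + (norm (\<Sum>i=1..n. edge_dir A i))\<^sup>2"
  from assms have n: "1 \<le> n" and A: "\<forall>i\<in>{1..n}. A i \<noteq> A 0"
    by (auto simp: star_shaped_graph_def)
  define c where "c = (\<Sum>i=0..n. A i) /\<^sub>R real (Suc n)"
  let ?D = "\<Sum>i=0..n. (norm (A i - c))\<^sup>2"
  have "real (Suc n) *\<^sub>R c = (\<Sum>i=0..n. A i)" by (simp add: c_def del: of_nat_Suc)
  then have "(\<Sum>i=0..n. A i - c) = 0"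
    by (simp add: sum_subtractf sum_constant_scaleR del: sum_constant of_nat_Suc)
  with A have upper: "?ev * ?D \<le> ?L" by (rule first_eigenvalue_mult_variance_le)
  have L: "0 < ?L" using n A by (intro sum_pos) (auto simp: edge_length_def)
  have S: "0 \<le> ?S" by simp
  \<comment> \<open>The sign of \<open>?ev\<close> matters for multiplying the Cauchy-Schwarz bound
    by it. A real \<open>Inf\<close> is known to be nonnegative only once its set is nonempty;
    splitting cases replaces exhibiting an admissible function.\<close>
  show ?thesis
  proof (cases "0 \<le> ?ev")
    case True
    have "?ev * ?L\<^sup>2 \<le> ?ev * (?D * ?S)"
      using True sum_edge_length_power2_le[OF A] by (rule mult_left_mono[rotated])
    also have "\<dots> \<le> ?L * ?S"
      using mult_right_mono[OF upper S] by (simp only: mult.assoc)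
    finally have "?L * (?ev * ?L) \<le> ?L * ?S" by (simp only: power2_eq_square mult_ac)
    with L show ?thesis by (simp only: mult_le_cancel_left_pos)
  next
    case False
    then have "?ev * ?L \<le> 0" using L by (intro mult_nonpos_nonneg) auto
    with S show ?thesis by linarith
  qed
qed

end
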